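(* Let $p,q$ be positive integers. There is a function $\psi:\mathbb{R}^p\to\mathbb{R}^q$ with the following property. Let $n,d$ be positive integers with $d<n$ and $p\leq n-d\leq q$, and let $f:\mathbb{R}^p\times\mathbb{R}^q\times\mathbb{R}^d\to\mathbb{R}^{n-d}$, $(y,\omega,t)\mapsto f(y,\omega,t)$, be measurable. Suppose that for almost every fixed $t\in\mathbb{R}^d$ the map $(y,\omega)\mapsto f(y,\omega,t)$ is $C^1$ on $\mathbb{R}^p\times\mathbb{R}^q$, its Jacobian $\frac{\partial f}{\partial\omega}(y,\omega,t)$ with respect to $\omega$ (an $(n-d)\times q$ matrix) has full rank $n-d$ at every $(y,\omega)$, and this Jacobian $\frac{\partial f}{\partial\omega}$ is Lipschitz as a function of $(y,\omega)$. Then the set $$E_f:=\bigcup_{y\in\mathbb{R}^p}\Gamma(y,\psi(y))\subseteq\mathbb{R}^n$$ has $n$-dimensional Lebesgue measure zero.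
   Context: For $f:\mathbb{R}^p\times\mathbb{R}^q\times\mathbb{R}^d\to\mathbb{R}^{n-d}$ and $(y,\omega)\in\mathbb{R}^p\times\mathbb{R}^q$, define $$\Gamma(y,\omega):=\left\{\begin{pmatrix}f(y,\omega,t)\\ t\end{pmatrix}:t\in\mathbb{R}^d\right\}\subseteq\mathbb{R}^{n-d}\times\mathbb{R}^d=\mathbb{R}^n.$$ The function $\psi$ depends only on $p$ and $q$; it does not depend on $f$. *)

theory Defs
  imports "HOL-Analysis.Analysis"
begin

text \<open>
  The dimensions \<open>n\<close> and \<open>d\<close> are quantified inside the scope of \<open>\<psi>\<close>, so they cannot be type
  parameters.  A point of Euclidean \<open>n\<close>-space is therefore an extensional function on \<open>{..<n}\<close>, and
  Lebesgue measure is the completed product of \<open>n\<close> copies of \<open>lborel\<close>.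
\<close>

definition lborel_n :: "nat \<Rightarrow> (nat \<Rightarrow> real) measure" where
  "lborel_n n = (\<Pi>\<^sub>M i\<in>{..<n}. lborel)"

definition lebesgue_n :: "nat \<Rightarrow> (nat \<Rightarrow> real) measure" where
  "lebesgue_n n = completion (lborel_n n)"

definition stack :: "nat \<Rightarrow> nat \<Rightarrow> (nat \<Rightarrow> real) \<Rightarrow> (nat \<Rightarrow> real) \<Rightarrow> (nat \<Rightarrow> real)" where
  "stack m d x t = (\<lambda>i\<in>{..<m + d}. if i < m then x i else t (i - m))"

definition Gam :: "nat \<Rightarrow> nat \<Rightarrow> (real^'p \<Rightarrow> real^'q \<Rightarrow> (nat \<Rightarrow> real) \<Rightarrow> (nat \<Rightarrow> real))
    \<Rightarrow> real^'p \<Rightarrow> real^'q \<Rightarrow> (nat \<Rightarrow> real) set" where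
  "Gam n d f y w = {stack (n - d) d (f y w t) t |t. t \<in> space (lborel_n d)}"

definition E_set :: "nat \<Rightarrow> nat \<Rightarrow> (real^'p \<Rightarrow> real^'q \<Rightarrow> (nat \<Rightarrow> real) \<Rightarrow> (nat \<Rightarrow> real))
    \<Rightarrow> (real^'p \<Rightarrow> real^'q) \<Rightarrow> (nat \<Rightarrow> real) set" where
  "E_set n d f \<psi> = (\<Union>y. Gam n d f y (\<psi> y))"

text \<open>Lebesgue measurability of \<open>f\<close>: the domain carries the completed product measure.\<close>

definition leb_measurable :: "nat \<Rightarrow> nat
    \<Rightarrow> (real^'p \<Rightarrow> real^'q \<Rightarrow> (nat \<Rightarrow> real) \<Rightarrow> (nat \<Rightarrow> real)) \<Rightarrow> bool" where
  "leb_measurable m d f \<longleftrightarrow>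
     (\<lambda>(y, w, t). f y w t) \<in> completion (lborel \<Otimes>\<^sub>M lborel \<Otimes>\<^sub>M lborel_n d) \<rightarrow>\<^sub>M lborel_n m"

definition C1 :: "('a::real_normed_vector \<Rightarrow> real) \<Rightarrow> bool" where
  "C1 g \<longleftrightarrow> (\<exists>D :: 'a \<Rightarrow> ('a \<Rightarrow>\<^sub>L real).
     (\<forall>x. (g has_derivative blinfun_apply (D x)) (at x)) \<and> continuous_on UNIV D)"

text \<open>Row \<open>i\<close> of the Jacobian matrix of \<open>w \<mapsto> f y w t\<close>.\<close>

definition jac_row :: "(real^'p \<Rightarrow> real^'q \<Rightarrow> (nat \<Rightarrow> real) \<Rightarrow> (nat \<Rightarrow> real))
    \<Rightarrow> (nat \<Rightarrow> real) \<Rightarrow> (real^'p) \<times> (real^'q) \<Rightarrow> nat \<Rightarrow> real^'q" where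
  "jac_row f t z i = (\<chi> j. deriv (\<lambda>s. f (fst z) (snd z + s *\<^sub>R axis j 1) t i) 0)"

text \<open>
  A matrix with \<open>m\<close> rows is given by its rows \<open>A i\<close>, \<open>i < m\<close>.  As in \<open>row_rank_def\<close>, its rank is the
  dimension of the set of its rows.
\<close>

definition rows_rank :: "nat \<Rightarrow> (nat \<Rightarrow> real^'q) \<Rightarrow> nat" where
  "rows_rank m A = dim (A ` {..<m})"

text \<open>
  Lipschitz continuity with respect to the Frobenius norm; since all norms on matrices of a fixed
  size are equivalent, the choice of norm only affects the constant.
\<close>

definition rows_lipschitz :: "nat \<Rightarrow> ('a::metric_space \<Rightarrow> nat \<Rightarrow> real^'q) \<Rightarrow> bool" where
  "rows_lipschitz m J \<longleftrightarrow>
     (\<exists>L\<ge>0. \<forall>z z'. L2_set (\<lambda>i. dist (J z i) (J z' i)) {..<m} \<le> L * dist z z')"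

end

theory Submission
  imports Defs
begin

text \<open>
  Let \<open>\<delta>\<^sub>k = 4\<close> to the power \<open>- k\<^sup>2\<close>, let \<open>c\<^sub>k y\<close> be the corner of the half-open \<open>\<delta>\<^sub>k\<close>-cube containing
  \<open>y\<close>, and let \<open>L\<^sub>k\<close> run through a countable dense set of \<open>q \<times> p\<close> matrices, each infinitely often and
  with norm at most \<open>k\<close>.  Then \<open>\<psi> y = (\<Sum>k. L\<^sub>k (c\<^bsub>k+1\<^esub> y - c\<^sub>k y))\<close> has, on each cube of side \<open>\<delta>\<^sub>k\<close>,
  slope \<open>L\<^sub>k\<close> up to an error \<open>o(\<delta>\<^sub>k)\<close>.

  Fix a good \<open>t\<close> and a point \<open>y\<close>, and let \<open>A, B\<close> be the derivatives of \<open>f\<close> in \<open>y\<close> and \<open>\<omega>\<close> at \<open>(y, \<psi> y)\<close>.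
  As \<open>B\<close> is onto, \<open>A + B L = 0\<close> for some \<open>L\<close>, and \<open>L\<^sub>k\<close> is close to \<open>L\<close> for infinitely many \<open>k\<close>; hence
  \<open>y \<mapsto> f (y, \<psi> y, t)\<close> maps the \<open>\<delta>\<^sub>k\<close>-cube around \<open>y\<close> into a cube of side \<open>\<epsilon> \<delta>\<^sub>k\<close>.  The largest such cubes
  are disjoint, so, since \<open>p \<le> n - d\<close>, the images of those inside a unit cube have total measure
  \<open>O(\<epsilon>)\<close>, and the \<open>t\<close>-slice of \<open>E_f\<close> is null.  To conclude by Fubini one needs a measurable
  cover: which cubes are selected at \<open>t\<close> is tested on a countable set over which the graph of \<open>\<psi>\<close> is
  dense.
\<close>

subsection \<open>The universal function\<close>

text \<open>The quadratic exponent makes \<open>side (Suc k) / side k\<close> tend to zero, so that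
  all later scales together are negligible against \<open>side k\<close>, even with matrices whose
  norms grow with the scale. Powers of an integer keep the grids nested.\<close>

definition side :: "nat \<Rightarrow> real" where
  "side k = 1 / 4 ^ k\<^sup>2"

text \<open>A cell is named by its integer index vector. These vectors form a countable type, so
  unions over all cells are countable.\<close>

definition cell :: "nat \<Rightarrow> real^'p \<Rightarrow> 'p \<Rightarrow> int" where
  "cell k y = (\<lambda>i. \<lfloor>y $ i / side k\<rfloor>)"

definition corner :: "nat \<Rightarrow> ('p \<Rightarrow> int) \<Rightarrow> real^'p" where
  "corner k q = (\<chi> i. of_int (q i) * side k)"

lemma side_pos [simp]: "0 < side k" and side_le_1: "side k \<le> 1" and side_0 [simp]: "side 0 = 1"
  by (auto simp: side_def)

lemma side_nonneg [simp]: "0 \<le> side k"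
  using side_pos[of k] by linarith

lemma side_nonzero [simp]: "side k \<noteq> 0"
  using side_pos[of k] by linarith

lemma cell_corner:
  assumes "cell k y = q"
  shows "corner k q $ i \<le> y $ i" "y $ i < corner k q $ i + side k"
proof -
  have *: "of_int (q i) \<le> y $ i / side k" "y $ i / side k < of_int (q i) + 1"
    using assms by (auto simp: cell_def)
  show "corner k q $ i \<le> y $ i"
    using *(1) by (simp add: corner_def pos_le_divide_eq)
  show "y $ i < corner k q $ i + side k"
    using *(2) by (simp add: corner_def pos_divide_less_eq algebra_simps)
qed

lemma cell_eqI:
  assumes "\<And>i. corner k q $ i \<le> y $ i" "\<And>i. y $ i < corner k q $ i + side k"
  shows "cell k y = q"
proof
  fix i
  have "of_int (q i) \<le> y $ i / side k" "y $ i / side k < of_int (q i) + 1"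
    using assms[of i] by (auto simp: corner_def pos_le_divide_eq pos_divide_less_eq algebra_simps)
  then show "cell k y i = q i"
    by (simp add: cell_def floor_eq_iff)
qed

lemma cell_of_corner [simp]: "cell k (corner k q) = q"
  by (rule cell_eqI) auto

text \<open>Nestedness of the grids: \<open>side j / side k\<close> is a natural number, so the
  coarse index is the integer quotient of the fine one.\<close>

lemma cell_coarser:
  assumes "j \<le> k" "cell k y = cell k y'"
  shows "cell j y = cell j y'"
proof
  fix i
  have le: "j\<^sup>2 \<le> k\<^sup>2"
    using assms(1) by (simp add: power_mono)
  have eq: "z / side j = (z / side k) / real_of_int (4 ^ (k\<^sup>2 - j\<^sup>2))" for z
  proof -
    have "(4::real) ^ k\<^sup>2 = 4 ^ (k\<^sup>2 - j\<^sup>2) * 4 ^ j\<^sup>2"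
      using le by (simp flip: power_add)
    then show ?thesis by (simp add: side_def)
  qed
  have "\<lfloor>y $ i / side k\<rfloor> = \<lfloor>y' $ i / side k\<rfloor>"
    using assms(2) by (metis cell_def)
  then show "cell j y i = cell j y' i"
    unfolding cell_def eq by (subst (1 2) floor_divide_real_eq_div) auto
qed

lemma cell_dist:
  fixes y y' :: "real^'p"
  assumes "cell k y = cell k y'"
  shows "norm (y' - y) \<le> CARD('p) * side k"
proof -
  have "norm (y' - y) \<le> (\<Sum>i\<in>UNIV. \<bar>(y' - y) $ i\<bar>)"
    by (rule norm_le_l1_cart)
  also have "\<dots> \<le> (\<Sum>i\<in>(UNIV::'p set). side k)"
  proof (rule sum_mono)
    fix i
    show "\<bar>(y' - y) $ i\<bar> \<le> side k"
      using cell_corner[OF refl, where k = k and y = y and i = i]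
        cell_corner[OF refl, where k = k and y = y' and i = i] assms
      by (simp add: abs_le_iff)
  qed
  finally show ?thesis by simp
qed

text \<open>The factor \<open>j\<close> stands for the norm bound on the matrix at scale
  \<open>j\<close>. The exponent gains at least \<open>k + j\<close>: the part \<open>4 ^ k\<close>
  is kept as smallness relative to \<open>side k\<close>, while \<open>(1/4) ^ j\<close> absorbs
  \<open>j\<close> \<le> \<open>2 ^ j\<close> and still leaves a geometric series.\<close>

lemma side_decay:
  assumes "k < j"
  shows "real j * side j \<le> side k / 4 ^ k * (1/2) ^ j"
proof -
  have "k\<^sup>2 + (k + j) \<le> j\<^sup>2"
  proof -
    obtain i where "j = Suc (k + i)" using assms less_iff_Suc_add by blast
    then show ?thesis by (simp add: power2_eq_square algebra_simps)
  qed
  then have "(4::real) ^ (k\<^sup>2 + (k + j)) \<le> 4 ^ j\<^sup>2"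
    by (rule power_increasing) auto
  then have "side j \<le> 1 / 4 ^ (k\<^sup>2 + (k + j))"
    unfolding side_def by (simp add: frac_le)
  also have "\<dots> = side k / 4 ^ k * (1/4) ^ j"
    by (simp add: side_def power_add power_divide)
  finally have *: "side j \<le> side k / 4 ^ k * (1/4) ^ j" .
  have "real j \<le> 2 ^ j"
    by (metis less_imp_le of_nat_less_two_power)
  then have "real j * side j \<le> 2 ^ j * (side k / 4 ^ k * (1/4) ^ j)"
    using * by (intro mult_mono) auto
  also have "\<dots> = side k / 4 ^ k * (2 * (1/4)) ^ j"
    by (simp only: power_mult_distrib) (simp add: mult_ac)
  finally show ?thesis by simp
qed

section \<open>The staircase series and its slope on a cell\<close>

definition approx :: "nat \<Rightarrow> real^'p \<Rightarrow> real^'p" where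
  "approx k y = corner k (cell k y)"

text \<open>With a constant sequence \<open>L\<close> the series telescopes to that matrix applied
  to \<open>y - approx 0 y\<close>; a varying \<open>L\<close> prescribes a separate slope at every
  scale.\<close>

definition staircase :: "(nat \<Rightarrow> real^'p^'q) \<Rightarrow> real^'p \<Rightarrow> real^'q" where
  "staircase L y = (\<Sum>k. L k *v (approx (Suc k) y - approx k y))"

lemma approx_dist:
  fixes y :: "real^'p"
  shows "norm (y - approx k y) \<le> CARD('p) * side k"
  unfolding approx_def by (rule cell_dist) simp

lemma approx_step:
  fixes y :: "real^'p"
  shows "norm (approx (Suc k) y - approx k y) \<le> 2 * CARD('p) * side k"
proof -
  have "side (Suc k) \<le> side k"
    unfolding side_def by (intro frac_le power_increasing power_mono) auto
  then have "real CARD('p) * side (Suc k) \<le> real CARD('p) * side k"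
    by (intro mult_left_mono) auto
  moreover have "norm (approx (Suc k) y - approx k y)
      \<le> norm (y - approx k y) + norm (y - approx (Suc k) y)"
    using norm_triangle_ineq4[of "y - approx k y" "y - approx (Suc k) y"] by simp
  ultimately show ?thesis
    using approx_dist[of y k] approx_dist[of y "Suc k"] by linarith
qed

lemma matrix_vector_norm_le:
  fixes A :: "real^'p^'q"
  assumes "onorm ((*v) A) \<le> c"
  shows "norm (A *v x) \<le> c * norm x"
proof -
  have "norm (A *v x) \<le> onorm ((*v) A) * norm x"
    by (rule onorm) simp
  also have "\<dots> \<le> c * norm x"
    using assms by (intro mult_right_mono) auto
  finally show ?thesis .
qed

lemma staircase_term:
  fixes L :: "nat \<Rightarrow> real^'p^'q"
  assumes L: "\<And>k. onorm ((*v) (L k)) \<le> real k"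
  shows "norm (L k *v (approx (Suc k) y - approx k y)) \<le> 2 * CARD('p) * (real k * side k)"
proof -
  have "norm (L k *v (approx (Suc k) y - approx k y)) \<le> real k * (2 * CARD('p) * side k)"
    by (rule order_trans[OF matrix_vector_norm_le[OF L] mult_left_mono[OF approx_step]]) auto
  then show ?thesis by (simp add: mult_ac)
qed

lemma summable_staircase:
  fixes L :: "nat \<Rightarrow> real^'p^'q"
  assumes L: "\<And>k. onorm ((*v) (L k)) \<le> real k"
  shows "summable (\<lambda>k. L k *v (approx (Suc k) y - approx k y))"
proof (rule summable_comparison_test')
  show "summable (\<lambda>k. 2 * CARD('p) * (1/2::real) ^ k)"
    by (intro summable_mult summable_geometric) auto
  fix k :: nat
  assume "1 \<le> k"
  have "norm (L k *v (approx (Suc k) y - approx k y)) \<le> 2 * CARD('p) * (real k * side k)"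
    by (rule staircase_term[OF L])
  also have "\<dots> \<le> 2 * CARD('p) * (1/2) ^ k"
    using side_decay[of 0 k] \<open>1 \<le> k\<close> by (intro mult_left_mono) auto
  finally show "norm (L k *v (approx (Suc k) y - approx k y)) \<le> 2 * CARD('p) * (1/2) ^ k" .
qed

text \<open>Terms before \<open>k\<close> cancel because the two points share their coarser cells,
  term \<open>k\<close> produces the slope \<open>L k\<close>, and later terms are summed by
  \<open>side_decay\<close>. The error carries the extra factor \<open>1 / 4 ^ k\<close>, hence is
  of smaller order than \<open>side k\<close>.\<close>

lemma staircase_local:
  fixes L :: "nat \<Rightarrow> real^'p^'q"
  assumes L: "\<And>k. onorm ((*v) (L k)) \<le> real k" and cell: "cell k y = cell k y'"
  shows "norm (staircase L y' - staircase L y - L k *v (y' - y)) \<le> 10 * CARD('p) * (side k / 4 ^ k)"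
proof -
  let ?P = "real CARD('p)"
  define a where "a j = L j *v (approx (Suc j) y' - approx j y') - L j *v (approx (Suc j) y - approx j y)" for j
  define b where "b j = norm (approx (Suc j) y' - approx j y') + norm (approx (Suc j) y - approx j y)" for j
  define e where "e = side k / 4 ^ k"
  have e0: "0 \<le> e" by (simp add: e_def)
  have "summable a"
    unfolding a_def by (intro summable_diff summable_staircase L)
  have "staircase L y' - staircase L y = suminf a"
    unfolding staircase_def a_def by (intro suminf_diff summable_staircase L)
  also have "\<dots> = (\<Sum>j. a (j + Suc k)) + (\<Sum>j<Suc k. a j)"
    by (rule suminf_split_initial_segment) fact
  \<comment> \<open>For \<open>j < k\<close> both \<open>j\<close> and \<open>Suc j\<close> are at
    most \<open>k\<close>, so \<open>y\<close> and \<open>y'\<close> have the same two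
    approximations.\<close>
  also have "(\<Sum>j<Suc k. a j) = a k"
  proof -
    have "a j = 0" if "j < k" for j
      using cell_coarser[OF _ cell, of j] cell_coarser[OF _ cell, of "Suc j"] that
      by (simp add: a_def approx_def)
    then show ?thesis by simp
  qed
  finally have 1: "staircase L y' - staircase L y = (\<Sum>j. a (j + Suc k)) + a k" .
  have tail: "norm (a (j + Suc k)) \<le> 4 * ?P * e * (1/2) ^ j" for j
  proof -
    let ?j = "j + Suc k"
    have "norm (a ?j) \<le> norm (L ?j *v (approx (Suc ?j) y' - approx ?j y')) + norm (L ?j *v (approx (Suc ?j) y - approx ?j y))"
      unfolding a_def by (rule norm_triangle_ineq4)
    also have "\<dots> \<le> 2 * CARD('p) * (real ?j * side ?j) + 2 * CARD('p) * (real ?j * side ?j)"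
      by (intro add_mono staircase_term[OF L])
    also have "\<dots> = 4 * ?P * (real ?j * side ?j)"
      by (simp add: algebra_simps)
    also have "\<dots> \<le> 4 * ?P * (e * (1/2) ^ ?j)"
      unfolding e_def by (intro mult_left_mono side_decay) auto
    also have "\<dots> \<le> 4 * ?P * (e * (1/2) ^ j)"
      using e0 by (intro mult_left_mono power_decreasing) auto
    finally show ?thesis by (simp add: mult_ac)
  qed
  have sg: "summable (\<lambda>j. 4 * ?P * e * (1/2::real) ^ j)"
    by (intro summable_mult summable_geometric) auto
  have "norm (\<Sum>j. a (j + Suc k)) \<le> (\<Sum>j. 4 * ?P * e * (1/2) ^ j)"
    by (rule norm_suminf_le[OF tail sg]) 
  also have "\<dots> = 4 * ?P * e * 2"
    by (subst suminf_mult) (auto simp: suminf_geometric intro!: summable_geometric)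
  finally have 2: "norm (\<Sum>j. a (j + Suc k)) \<le> 8 * ?P * e"
    by (simp add: mult_ac)
  \<comment> \<open>As \<open>approx k\<close> agrees at both points, the deviation from the exact
    linear increment consists of the remainders of \<open>y\<close> and \<open>y'\<close> at scale
    \<open>Suc k\<close>.\<close>
  have "a k - L k *v (y' - y) = L k *v ((y - approx (Suc k) y) - (y' - approx (Suc k) y'))"
    using cell by (simp add: a_def approx_def matrix_vector_mult_diff_distrib algebra_simps)
  also have "norm \<dots> \<le> real k * norm ((y - approx (Suc k) y) - (y' - approx (Suc k) y'))"
    by (rule matrix_vector_norm_le[OF L])
  also have "\<dots> \<le> real (Suc k) * (?P * side (Suc k) + ?P * side (Suc k))"
    by (intro mult_mono order_trans[OF norm_triangle_ineq4 add_mono] approx_dist) auto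
  also have "\<dots> = 2 * ?P * (real (Suc k) * side (Suc k))"
    by (simp add: algebra_simps)
  also have "\<dots> \<le> 2 * ?P * (e * (1/2) ^ Suc k)"
    unfolding e_def by (intro mult_left_mono side_decay) auto
  also have "\<dots> \<le> 2 * ?P * (e * 1)"
    using e0 by (intro mult_left_mono power_le_one) auto
  finally have 3: "norm (a k - L k *v (y' - y)) \<le> 2 * ?P * e" by simp
  \<comment> \<open>The constant 10 is 8 from the tail plus 2 from the remainder of term
    \<open>k\<close>.\<close>
  have "staircase L y' - staircase L y - L k *v (y' - y) = (\<Sum>j. a (j + Suc k)) + (a k - L k *v (y' - y))"
    using 1 by simp
  also have "norm \<dots> \<le> 8 * ?P * e + 2 * ?P * e"
    by (rule order_trans[OF norm_triangle_ineq add_mono[OF 2 3]])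
  finally show ?thesis by (simp add: e_def mult_ac)
qed

subsection \<open>Flat cells at every point\<close>

text \<open>Reading only the first component of \<open>prod_decode k\<close> repeats each member of
  a countable dense set infinitely often. The default 0 enforces the growth bound and suppresses
  only finitely many occurrences of each matrix.\<close>

lemma exists_dense_sequence:
  "\<exists>L :: nat \<Rightarrow> real^'p^'q. (\<forall>k. onorm ((*v) (L k)) \<le> real k) \<and>
     (\<forall>M e. 0 < e \<longrightarrow> (\<exists>M'. dist M' M < e \<and> (\<forall>n. \<exists>k\<ge>n. L k = M')))"
proof -
  obtain D :: "(real^'p^'q) set" where D: "countable D" "\<And>X. open X \<Longrightarrow> X \<noteq> {} \<Longrightarrow> \<exists>d\<in>D. d \<in> X"
    using countable_dense_exists by blast
  define N where "N k = from_nat_into D (fst (prod_decode k))" for k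
  define L where "L k = (if onorm ((*v) (N k)) \<le> real k then N k else 0)" for k
  have "onorm ((*v) (L k)) \<le> real k" for k
  proof -
    have "((*v) (0::real^'p^'q)) = (\<lambda>x. 0)" by auto
    then show ?thesis by (simp add: L_def onorm_zero)
  qed
  moreover have "\<exists>M'. dist M' M < e \<and> (\<forall>n. \<exists>k\<ge>n. L k = M')" if e: "0 < e" for M e
  proof -
    obtain M' where M': "M' \<in> D" "M' \<in> ball M e"
      using D(2)[of "ball M e"] e by (metis centre_in_ball empty_iff open_ball)
    have "\<exists>k\<ge>n. L k = M'" for n
    proof -
      \<comment> \<open>The first component selects \<open>M'\<close>. The second pushes
        \<open>k\<close> beyond both \<open>n\<close> and the norm of \<open>M'\<close>, since a
        pair code is at least its second component.\<close>
      define k where "k = prod_encode (to_nat_on D M', n + nat \<lceil>onorm ((*v) M')\<rceil>)"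
      have k: "n + nat \<lceil>onorm ((*v) M')\<rceil> \<le> k"
        unfolding k_def by (rule le_prod_encode_2)
      have "N k = M'"
        using M' D(1) by (simp add: N_def k_def)
      moreover have "onorm ((*v) M') \<le> real k"
        using k by linarith
      ultimately show ?thesis using k by (intro exI[of _ k]) (simp add: L_def)
    qed
    then show ?thesis using M' by (auto simp: dist_commute)
  qed
  ultimately show ?thesis by blast
qed

section \<open>Solving the linearised equation\<close>

lemma dual_family:
  fixes b :: "nat \<Rightarrow> real^'q"
  assumes "rows_rank m b = m"
  obtains v where "\<And>i j. i < m \<Longrightarrow> j < m \<Longrightarrow> b i \<bullet> v j = (if i = j then 1 else 0)"
proof -
  let ?B = "b ` {..<m}"
  \<comment> \<open>The rank is the dimension of a set of rows, so rank \<open>m\<close> also forces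
    the \<open>m\<close> rows to be pairwise distinct.\<close>
  have "dim ?B \<le> card ?B" by (rule dim_le_card') simp
  moreover have "card ?B \<le> m" using card_image_le[of "{..<m}" b] by simp
  ultimately have card: "card ?B = m" "dim ?B = card ?B"
    using assms by (auto simp: rows_rank_def)
  have inj: "inj_on b {..<m}"
    using card by (intro eq_card_imp_inj_on) auto
  have ind: "independent ?B"
    by (rule card_le_dim_spanning[of _ ?B]) (auto simp: card span_superset span_base)
  have "\<exists>v. \<forall>i<m. b i \<bullet> v = (if i = j then 1 else 0)" if "j < m" for j
  proof -
    obtain g :: "real^'q \<Rightarrow> real" where g: "linear g" "\<And>x. x \<in> ?B \<Longrightarrow> g x = (if x = b j then 1 else 0)"
      using linear_independent_extend[OF ind, of "\<lambda>x. if x = b j then 1 else 0"] by auto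
    \<comment> \<open>\<open>adjoint g 1\<close> is the vector representing the functional
      \<open>g\<close> through the inner product.\<close>
    have "b i \<bullet> adjoint g 1 = (if i = j then 1 else 0)" if "i < m" for i
      using g(2)[of "b i"] inj that \<open>j < m\<close> by (auto simp: adjoint_works[OF g(1)] inj_on_eq_iff)
    then show ?thesis by blast
  qed
  then obtain v where "\<And>j. j < m \<Longrightarrow> \<forall>i<m. b i \<bullet> v j = (if i = j then 1 else 0)"
    by metis
  then show ?thesis using that by blast
qed

text \<open>This solves \<open>A + B L = 0\<close> from the opening comment: the dual vectors form a
  right inverse of \<open>B\<close>, and \<open>G\<close> applies it to
  \<open>- A u\<close>.\<close>

lemma kernel_matrix:
  fixes D :: "nat \<Rightarrow> (real^'p) \<times> (real^'q) \<Rightarrow> real"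
  assumes lin: "\<And>i. i < m \<Longrightarrow> linear (D i)"
    and b: "\<And>i v. i < m \<Longrightarrow> D i (0, v) = b i \<bullet> v" and rank: "rows_rank m b = m"
  obtains M :: "real^'p^'q" where "\<And>i u. i < m \<Longrightarrow> D i (u, M *v u) = 0"
proof -
  obtain v where v: "\<And>i j. i < m \<Longrightarrow> j < m \<Longrightarrow> b i \<bullet> v j = (if i = j then 1 else 0)"
    using dual_family[OF rank] by blast
  define G where "G u = (\<Sum>j<m. (- D j (u, 0)) *\<^sub>R v j)" for u :: "real^'p"
  have "linear (\<lambda>u. (- D j (u, 0)) *\<^sub>R v j)" if "j < m" for j
  proof -
    have *: "linear (\<lambda>u. D j (u, 0))"
      by (rule linear_compose[OF _ lin[OF that], unfolded o_def]) (auto intro!: linearI)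
    show ?thesis
      by (rule linearI) (simp_all add: linear_add[OF *] linear_scale[OF *] algebra_simps)
  qed
  then have "linear G"
    unfolding G_def by (intro linear_compose_sum) auto
  then have G: "matrix G *v u = G u" for u
    by (metis matrix_vector_mul(2))
  have "D i (u, matrix G *v u) = 0" if "i < m" for i u
  proof -
    have "b i \<bullet> G u = (\<Sum>j<m. if i = j then - D j (u, 0) else 0)"
      unfolding G_def inner_sum_right using v that by (intro sum.cong) auto
    also have "\<dots> = - D i (u, 0)"
      using that by simp
    finally have "b i \<bullet> G u = - D i (u, 0)" .
    moreover have "D i (u, G u) = D i (u, 0) + D i (0, G u)"
      using linear_add[OF lin[OF that], of "(u, 0)" "(0, G u)"] by simp
    ultimately show ?thesis
      using b[OF that] by (simp add: G)
  qed
  then show ?thesis by (rule that)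
qed

section \<open>Small oscillation on cells with nearly the right slope\<close>

lemma matrix_vector_norm_bound:
  fixes A :: "real^'p^'q"
  shows "norm (A *v u) \<le> real CARD('q) * real CARD('p) * norm A * norm u"
proof (rule matrix_vector_norm_le[OF onorm_le_matrix_component])
  fix i j
  show "\<bar>A $ i $ j\<bar> \<le> norm A"
    using component_le_norm_cart[of "A $ i" j] Finite_Cartesian_Product.norm_nth_le[of A i] by linarith
qed

lemma side_le_power: "side k \<le> (1/4) ^ k"
proof -
  have "k \<le> k\<^sup>2" by (simp add: power2_nat_le_imp_le self_le_power)
  then have "(4::real) ^ k \<le> 4 ^ k\<^sup>2" by (intro power_increasing) auto
  then show ?thesis by (simp add: side_def power_divide frac_le)
qed

lemma side_tendsto_0: "side \<longlonglongrightarrow> 0"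
  by (rule tendsto_sandwich[of "\<lambda>_. 0" _ _ "\<lambda>k. (1/4) ^ k"])
     (auto simp: side_le_power intro!: LIMSEQ_power_zero)

text \<open>If \<open>L k\<close> is close to the kernel matrix \<open>M\<close>, the increment of
  the graph over the cell is nearly \<open>(u, M *v u)\<close>, which every \<open>D i\<close>
  annihilates. Three errors remain: differentiability, the distance from \<open>L k\<close> to
  \<open>M\<close>, and the staircase error. Each is kept below a quarter of
  \<open>e * side k\<close>.\<close>

lemma staircase_flat:
  fixes \<phi> :: "nat \<Rightarrow> (real^'p) \<times> (real^'q) \<Rightarrow> real" and L :: "nat \<Rightarrow> real^'p^'q"
  assumes L: "\<And>k. onorm ((*v) (L k)) \<le> real k"
    and dense: "\<And>M e. 0 < e \<Longrightarrow> \<exists>M'. dist M' M < e \<and> (\<forall>n. \<exists>k\<ge>n. L k = M')"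
    and der: "\<And>i. i < m \<Longrightarrow> (\<phi> i has_derivative D i) (at (y, staircase L y))"
    and b: "\<And>i v. i < m \<Longrightarrow> D i (0, v) = b i \<bullet> v" and rank: "rows_rank m b = m"
    and e: "0 < e"
  shows "\<exists>k. \<forall>y'. cell k y' = cell k y \<longrightarrow>
    (\<forall>i<m. \<bar>\<phi> i (y', staircase L y') - \<phi> i (y, staircase L y)\<bar> \<le> e * side k)"
proof -
  let ?P = "real CARD('p)" and ?Q = "real CARD('q)"
  let ?z = "\<lambda>y. (y, staircase L y)"
  have lin: "linear (D i)" if "i < m" for i
    using der[OF that] has_derivative_linear by blast
  obtain M where M: "\<And>i u. i < m \<Longrightarrow> D i (u, M *v u) = 0"
    using kernel_matrix[OF lin b rank] by blast
  define \<beta> where "\<beta> = 1 + (\<Sum>i<m. norm (b i))"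
  have \<beta>: "norm (b i) \<le> \<beta>" if "i < m" for i
    using member_le_sum[of i "{..<m}" "\<lambda>i. norm (b i)"] that by (simp add: \<beta>_def)
  have \<beta>_pos: "0 < \<beta>"
    by (simp add: \<beta>_def sum_nonneg add_pos_nonneg)
  have PQ: "0 < ?P" "0 < ?Q" by auto
  \<comment> \<open>Chosen so that the tolerance \<open>e / c\<close> contributes exactly
    \<open>e / 4 * side k\<close>: \<open>\<beta>\<close> bounds the gradients,
    \<open>?Q * ?P\<close> comes from \<open>matrix_vector_norm_bound\<close>, the last
    \<open>?P\<close> from the cell diameter.\<close>
  define c where "c = 4 * \<beta> * ?Q * ?P * ?P"
  have c: "0 < c" using \<beta>_pos PQ by (simp add: c_def)
  obtain M' where M': "dist M' M < e / c" and freq: "\<And>n. \<exists>k\<ge>n. L k = M'"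
    using dense[of "e / c" M] e c by auto
  define K where "K = onorm ((*v) M')"
  have K: "0 \<le> K" by (simp add: K_def onorm_pos_le)
  \<comment> \<open>\<open>R * side k\<close> will bound the increment of the graph:
    \<open>?P\<close> for \<open>u\<close>, \<open>?P * K\<close> for \<open>M' *v u\<close>, and
    \<open>10 * ?P\<close> for the staircase error.\<close>
  define R where "R = ?P * (1 + K) + 10 * ?P"
  have R: "0 < R" using K PQ by (simp add: R_def add_nonneg_pos)
  have "\<forall>\<^sub>F k in sequentially. R * side k < r" if "0 < r" for r
  proof -
    have "(\<lambda>k. R * side k) \<longlonglongrightarrow> R * 0"
      by (intro tendsto_intros side_tendsto_0)
    then show ?thesis using that by (auto dest: order_tendstoD)
  qed
  note ev_R = this
  have ev_\<beta>: "\<forall>\<^sub>F k in sequentially. \<beta> * (10 * ?P) * (1/4) ^ k < e / 4"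
  proof -
    have "(\<lambda>k. \<beta> * (10 * ?P) * (1/4) ^ k) \<longlonglongrightarrow> \<beta> * (10 * ?P) * 0"
      by (intro tendsto_intros LIMSEQ_power_zero) auto
    from order_tendstoD(2)[OF this, of "e / 4"] show ?thesis using e by simp
  qed
  have ev: "\<forall>\<^sub>F k in sequentially. L k = M' \<longrightarrow> (\<forall>y'. cell k y' = cell k y \<longrightarrow>
      \<bar>\<phi> i (?z y') - \<phi> i (?z y)\<bar> \<le> e * side k)" if i: "i < m" for i
  proof -
    have "0 < e / (4 * R)" using e R by simp
    then obtain r where r: "0 < r" and
      near: "\<And>z'. norm (z' - ?z y) < r \<Longrightarrow>
        norm (\<phi> i z' - \<phi> i (?z y) - D i (z' - ?z y)) \<le> e / (4 * R) * norm (z' - ?z y)"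
      using der[OF i] unfolding has_derivative_at_alt by blast
    show ?thesis
      using ev_R[OF r] ev_\<beta>
    proof eventually_elim
      case (elim k)
      show ?case
      proof (intro impI allI)
        fix y' assume Lk: "L k = M'" and cell: "cell k y' = cell k y"
        define u where "u = y' - y"
        define v where "v = staircase L y' - staircase L y"
        define s where "s = v - M' *v u"
        have u: "norm u \<le> ?P * side k"
          unfolding u_def using cell by (intro cell_dist) simp
        have s: "norm s \<le> 10 * ?P * (1/4) ^ k * side k"
          using staircase_local[OF L, of k y y'] cell Lk
          by (simp add: s_def u_def v_def power_divide)
        have s': "norm s \<le> 10 * ?P * side k"
        proof -
          have "10 * ?P * (1/4) ^ k * side k \<le> 10 * ?P * 1 * side k"
            by (intro mult_right_mono mult_left_mono power_le_one) auto
          then show ?thesis using s by linarith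
        qed
        have Mu: "norm (M' *v u) \<le> K * (?P * side k)"
          using order_trans[OF matrix_vector_norm_le[of M' K u] mult_left_mono[OF u K]]
          by (simp add: K_def)
        have "norm v \<le> norm (M' *v u) + norm s"
          using norm_triangle_ineq[of "M' *v u" s] by (simp add: s_def)
        then have "norm (u, v) \<le> R * side k"
          using norm_Pair_le[of u v] u Mu s' by (simp add: R_def algebra_simps)
        then have "norm (u, v) < r"
          using elim(1) by linarith
        moreover have "?z y' - ?z y = (u, v)"
          by (simp add: u_def v_def)
        ultimately have "\<bar>\<phi> i (?z y') - \<phi> i (?z y) - D i (u, v)\<bar> \<le> e / (4 * R) * norm (u, v)"
          using near[of "?z y'"] by simp
        also have "\<dots> \<le> e / (4 * R) * (R * side k)"
          using \<open>norm (u, v) \<le> R * side k\<close> e R by (intro mult_left_mono) auto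
        finally have 1: "\<bar>\<phi> i (?z y') - \<phi> i (?z y) - D i (u, v)\<bar> \<le> e / (4 * R) * (R * side k)" .
        have "e / (4 * R) * (R * side k) = e / 4 * side k"
          using R by simp
        with 1 have 1: "\<bar>\<phi> i (?z y') - \<phi> i (?z y) - D i (u, v)\<bar> \<le> e / 4 * side k"
          by simp
        \<comment> \<open>Here \<open>v\<close> is split as
          \<open>M *v u + (M' - M) *v u + s\<close>.\<close>
        have "D i (u, v) = D i (u, M *v u) + D i (0, (M' - M) *v u) + D i (0, s)"
          using linear_add[OF lin[OF i], of "(u, M *v u)" "(0, (M' - M) *v u)"]
            linear_add[OF lin[OF i], of "(u, M' *v u)" "(0, s)"]
          by (simp add: s_def matrix_vector_mult_diff_rdistrib)
        then have 2: "D i (u, v) = b i \<bullet> ((M' - M) *v u) + b i \<bullet> s"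
          using M[OF i] b[OF i] by simp
        have "\<bar>b i \<bullet> ((M' - M) *v u)\<bar> \<le> norm (b i) * norm ((M' - M) *v u)"
          by (rule Cauchy_Schwarz_ineq2)
        also have "\<dots> \<le> \<beta> * (?Q * ?P * (e / c) * (?P * side k))"
          using M' u \<beta>[OF i] \<beta>_pos e c
          by (intro mult_mono order_trans[OF matrix_vector_norm_bound]) (auto simp: dist_norm)
        also have "\<dots> = e / 4 * side k"
          using \<beta>_pos PQ by (simp add: c_def field_simps)
        finally have 3: "\<bar>b i \<bullet> ((M' - M) *v u)\<bar> \<le> e / 4 * side k" .
        have "\<bar>b i \<bullet> s\<bar> \<le> norm (b i) * norm s"
          by (rule Cauchy_Schwarz_ineq2)
        also have "\<dots> \<le> \<beta> * (10 * ?P * (1/4) ^ k * side k)"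
          using s \<beta>[OF i] \<beta>_pos by (intro mult_mono) auto
        also have "\<dots> = (\<beta> * (10 * ?P) * (1/4) ^ k) * side k"
          by (simp add: mult_ac)
        also have "\<dots> \<le> e / 4 * side k"
          using elim(2) by (intro mult_right_mono) auto
        finally have 4: "\<bar>b i \<bullet> s\<bar> \<le> e / 4 * side k" .
        have "e / 4 * side k + e / 4 * side k + e / 4 * side k \<le> e * side k"
          using e by (simp add: mult_nonneg_nonneg)
        then show "\<bar>\<phi> i (?z y') - \<phi> i (?z y)\<bar> \<le> e * side k"
          using 1 2 3 4 by linarith
      qed
    qed
  qed
  have "\<forall>\<^sub>F k in sequentially. \<forall>i\<in>{..<m}. L k = M' \<longrightarrow> (\<forall>y'. cell k y' = cell k y \<longrightarrow>
      \<bar>\<phi> i (?z y') - \<phi> i (?z y)\<bar> \<le> e * side k)"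
    using ev by (intro eventually_ball_finite) auto
  then obtain n where n: "\<And>k. n \<le> k \<Longrightarrow> \<forall>i\<in>{..<m}. L k = M' \<longrightarrow> (\<forall>y'. cell k y' = cell k y \<longrightarrow>
      \<bar>\<phi> i (?z y') - \<phi> i (?z y)\<bar> \<le> e * side k)"
    unfolding eventually_sequentially by blast
  \<comment> \<open>Since \<open>M'\<close> recurs infinitely often, it is used at some scale beyond
    the threshold common to all components.\<close>
  obtain k where "n \<le> k" "L k = M'" using freq by blast
  then show ?thesis using n[of k] by (intro exI[of _ k]) auto
qed

subsection \<open>Measure of the image\<close>

lemma product_sigma_finite_lborel: "product_sigma_finite (\<lambda>i. lborel :: real measure)"
  by standard

lemma sigma_finite_lborel_n: "sigma_finite_measure (lborel_n m)"
  unfolding lborel_n_def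
  by (rule product_sigma_finite.sigma_finite[OF product_sigma_finite_lborel]) simp

lemma measurable_coordinate: "i < m \<Longrightarrow> (\<lambda>x. x i) \<in> borel_measurable (lborel_n m)"
  unfolding lborel_n_def using measurable_component_singleton[of i "{..<m}" "\<lambda>_. lborel"] by simp

lemma emeasure_lborel_n_cube:
  assumes "0 \<le> r"
  shows "{x \<in> space (lborel_n m). \<forall>i<m. \<bar>x i - c i\<bar> \<le> r} \<in> sets (lborel_n m)" (is ?A)
    and "emeasure (lborel_n m) {x \<in> space (lborel_n m). \<forall>i<m. \<bar>x i - c i\<bar> \<le> r} = ennreal ((2 * r) ^ m)" (is ?B)
proof -
  have *: "{x \<in> space (lborel_n m). \<forall>i<m. \<bar>x i - c i\<bar> \<le> r} = (\<Pi>\<^sub>E i\<in>{..<m}. {c i - r..c i + r})"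
  proof (rule set_eqI)
    fix x :: "nat \<Rightarrow> real"
    have "\<bar>x i - c i\<bar> \<le> r \<longleftrightarrow> x i \<in> {c i - r..c i + r}" for i
      by (simp only: abs_diff_le_iff atLeastAtMost_iff)
    then show "x \<in> {x \<in> space (lborel_n m). \<forall>i<m. \<bar>x i - c i\<bar> \<le> r} \<longleftrightarrow> x \<in> (\<Pi>\<^sub>E i\<in>{..<m}. {c i - r..c i + r})"
      by (simp add: lborel_n_def space_PiM PiE_iff Ball_def conj_commute)
  qed
  show ?A
    unfolding * unfolding lborel_n_def by (intro sets_PiM_I_finite) auto
  show ?B
    unfolding * unfolding lborel_n_def
    using assms by (subst product_sigma_finite.emeasure_PiM[OF product_sigma_finite_lborel])
      (auto simp: ennreal_power)
qed

text \<open>The interior of the half-open cell: as a \<open>box\<close> it has a known volume, and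
  its points still determine the cell.\<close>

definition open_cell :: "nat \<Rightarrow> ('p \<Rightarrow> int) \<Rightarrow> (real^'p) set" where
  "open_cell k q = box (corner k q) (corner k q + (\<chi> i. side k))"

lemma cell_open_cell: "y \<in> open_cell k q \<Longrightarrow> cell k y = q"
  by (rule cell_eqI) (auto simp: open_cell_def mem_box_cart less_imp_le)

lemma emeasure_open_cell:
  "emeasure lborel (open_cell k q :: (real^'p) set) = ennreal (side k ^ CARD('p))"
proof -
  have *: "(\<chi> i. side k) \<bullet> b = side k" if "b \<in> Basis" for b :: "real^'p"
    using that by (auto simp: Basis_vec_def inner_axis)
  have "emeasure lborel (open_cell k q :: (real^'p) set) =
      ennreal (\<Prod>b\<in>(Basis :: (real^'p) set). side k)"
    unfolding open_cell_def
    by (subst emeasure_lborel_box) (auto simp: inner_add_left * intro!: arg_cong[where f = ennreal] prod.cong)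
  then show ?thesis by simp
qed

text \<open>
  The hypothesis \<open>disj\<close> says that no cell of \<open>S\<close> lies in another one; as cells are nested, this makes
  them disjoint.
\<close>

lemma emeasure_disjoint_cells_cover:
  fixes S :: "(nat \<times> ('p::finite \<Rightarrow> int)) set"
  assumes p: "CARD('p) \<le> m" and e: "0 \<le> e"
    and unit: "\<And>k q. (k, q) \<in> S \<Longrightarrow> cell 0 (corner k q) = q0"
    and disj: "\<And>j k q. (k, q) \<in> S \<Longrightarrow> j < k \<Longrightarrow> (j, cell j (corner k q)) \<notin> S"
  shows "emeasure (lborel_n m)
    (\<Union>(k, q)\<in>S. {x \<in> space (lborel_n m). \<forall>i<m. \<bar>x i - c k q i\<bar> \<le> e * side k}) \<le> ennreal ((2 * e) ^ m)"
proof -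
  define A where "A k q = {x \<in> space (lborel_n m). \<forall>i<m. \<bar>x i - c k q i\<bar> \<le> e * side k}" for k q
  define X where "X n = (if n \<in> to_nat ` S then case_prod A (from_nat n) else {})" for n
  define B :: "nat \<Rightarrow> (real^'p) set" where
    "B n = (if n \<in> to_nat ` S then case_prod open_cell (from_nat n) else {})" for n
  have A_sets: "A k q \<in> sets (lborel_n m)" for k q
    unfolding A_def using e by (intro emeasure_lborel_n_cube) simp
  have X: "range X \<subseteq> sets (lborel_n m)"
    using A_sets by (auto simp: X_def)
  have B: "range B \<subseteq> sets lborel"
    by (auto simp: B_def open_cell_def)
  \<comment> \<open>A common point places the finer cell inside the coarser one, which
    \<open>disj\<close> excludes.\<close>
  have disj_le: "open_cell k q \<inter> open_cell j r = ({} :: (real^'p) set)"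
    if S: "(k, q) \<in> S" "(j, r) \<in> S" and ne: "(k, q) \<noteq> (j, r)" and jk: "j \<le> k" for k q j r
  proof (rule ccontr)
    assume "open_cell k q \<inter> open_cell j r \<noteq> ({} :: (real^'p) set)"
    then obtain y :: "real^'p" where y: "cell k y = q" "cell j y = r"
      using cell_open_cell by blast
    then have r: "cell j (corner k q) = r"
      using cell_coarser[OF jk, of "corner k q" y] by simp
    show False
    proof (cases "j = k")
      case True
      then show False using y ne by simp
    next
      case False
      then show False using disj[OF S(1), of j] S(2) r jk by simp
    qed
  qed
  have "open_cell k q \<inter> open_cell j r = ({} :: (real^'p) set)"
    if "(k, q) \<in> S" "(j, r) \<in> S" "(k, q) \<noteq> (j, r)" for k q j r
    using disj_le[OF that] disj_le[OF that(2,1)] that(3) by (metis Int_commute nat_le_linear)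
  then have cells: "case_prod open_cell s \<inter> case_prod open_cell s' = ({} :: (real^'p) set)"
    if "s \<in> S" "s' \<in> S" "s \<noteq> s'" for s s'
    using that by (cases s, cases s') auto
  have "disjoint_family B"
    unfolding disjoint_family_on_def
  proof (intro ballI impI)
    fix a b :: nat
    assume "a \<noteq> b"
    show "B a \<inter> B b = {}"
    proof (cases "a \<in> to_nat ` S \<and> b \<in> to_nat ` S")
      case True
      then obtain s s' where "s \<in> S" "s' \<in> S" "a = to_nat s" "b = to_nat s'"
        by blast
      with \<open>a \<noteq> b\<close> cells[of s s'] show ?thesis
        by (simp add: B_def)
    qed (auto simp: B_def)
  qed
  have AB: "emeasure (lborel_n m) (X n) \<le> ennreal ((2 * e) ^ m) * emeasure lborel (B n)" for n
  proof (cases "n \<in> to_nat ` S")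
    case True
    then obtain k q where kq: "(k, q) \<in> S" "n = to_nat (k, q)" by auto
    have "emeasure (lborel_n m) (X n) = ennreal ((2 * (e * side k)) ^ m)"
      using kq e by (simp add: X_def A_def emeasure_lborel_n_cube)
    also have "\<dots> = ennreal ((2 * e) ^ m * side k ^ m)"
      by (simp only: power_mult_distrib) (simp add: mult_ac)
    \<comment> \<open>The dimension hypothesis enters here: as \<open>side k\<close> \<le> 1, the
      image cube has at most a fixed multiple of the volume of its cell.\<close>
    also have "\<dots> \<le> ennreal ((2 * e) ^ m * side k ^ CARD('p))"
      using p e side_le_1[of k] by (intro ennreal_leI mult_left_mono power_decreasing) auto
    also have "\<dots> = ennreal ((2 * e) ^ m) * emeasure lborel (B n)"
      using kq e by (simp add: B_def emeasure_open_cell ennreal_mult)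
    finally show ?thesis .
  qed (simp add: X_def)
  have "B n \<subseteq> cbox (corner 0 q0) (corner 0 q0 + (\<chi> i. 1))" for n
  proof
    fix y assume "y \<in> B n"
    then obtain k q where kq: "(k, q) \<in> S" "y \<in> open_cell k q"
      by (auto simp: B_def split: if_splits)
    then have "cell 0 y = q0"
      using unit[OF kq(1)] cell_open_cell[OF kq(2)] cell_coarser[of 0 k y "corner k q"] by simp
    then show "y \<in> cbox (corner 0 q0) (corner 0 q0 + (\<chi> i. 1))"
      using cell_corner[of 0 y q0] by (auto simp: mem_box_cart less_imp_le)
  qed
  then have "emeasure lborel (\<Union>n. B n) \<le> emeasure lborel (cbox (corner 0 q0) (corner 0 q0 + (\<chi> i. 1)))"
    by (intro emeasure_mono) auto
  also have "\<dots> = 1"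
  proof -
    have *: "(\<chi> i. 1) \<bullet> b = 1" if "b \<in> Basis" for b :: "real^'p"
      using that by (auto simp: Basis_vec_def inner_axis)
    show ?thesis
      by (subst emeasure_lborel_cbox) (auto simp: inner_add_left *)
  qed
  finally have unit_B: "emeasure lborel (\<Union>n. B n) \<le> 1" .
  have "(\<Union>n. X n) = (\<Union>n\<in>to_nat ` S. case_prod A (from_nat n))"
    unfolding X_def by (auto split: if_splits)
  also have "\<dots> = (\<Union>(k, q)\<in>S. A k q)"
    by simp
  finally have "emeasure (lborel_n m) (\<Union>(k, q)\<in>S. A k q) \<le> (\<Sum>n. emeasure (lborel_n m) (X n))"
    using emeasure_subadditive_countably[OF X] by metis
  also have "\<dots> \<le> (\<Sum>n. ennreal ((2 * e) ^ m) * emeasure lborel (B n))"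
    by (intro suminf_le AB) auto
  also have "\<dots> = ennreal ((2 * e) ^ m) * emeasure lborel (\<Union>n. B n)"
    using suminf_emeasure[OF B \<open>disjoint_family B\<close>] by simp
  also have "\<dots> \<le> ennreal ((2 * e) ^ m) * 1"
    by (intro mult_left_mono unit_B) auto
  finally show ?thesis by (simp add: A_def)
qed

text \<open>
  \<open>g\<close> is a measurable version of \<open>h\<close>, and \<open>C k q\<close> a countable test set for the oscillation of \<open>h\<close> on
  the cell \<open>q\<close>.
\<close>

lemma null_cover_of_flat_cells:
  fixes h g :: "real^'p \<Rightarrow> 't \<Rightarrow> nat \<Rightarrow> real" and C :: "nat \<Rightarrow> ('p \<Rightarrow> int) \<Rightarrow> (real^'p) set"
  assumes M: "sigma_finite_measure M" and p: "CARD('p) \<le> m"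
    and g: "\<And>y i. i < m \<Longrightarrow> (\<lambda>t. g y t i) \<in> borel_measurable M"
    and C: "\<And>k q. countable (C k q)" "\<And>k q. corner k q \<in> C k q" "\<And>k q y. y \<in> C k q \<Longrightarrow> cell k y = q"
    and eq: "AE t in M. \<forall>k q. \<forall>y\<in>C k q. \<forall>i<m. h y t i = g y t i"
    and dense: "AE t in M. \<forall>k q e. (\<forall>y\<in>C k q. \<forall>i<m. \<bar>h y t i - h (corner k q) t i\<bar> \<le> e) \<longrightarrow>
        (\<forall>y. cell k y = q \<longrightarrow> (\<forall>i<m. \<bar>h y t i - h (corner k q) t i\<bar> \<le> e))"
    and flat: "AE t in M. \<forall>y e. 0 < e \<longrightarrow> (\<exists>k. \<forall>y'. cell k y' = cell k y \<longrightarrow>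
        (\<forall>i<m. \<bar>h y' t i - h y t i\<bar> \<le> e * side k))"
  shows "\<exists>W\<in>null_sets (M \<Otimes>\<^sub>M lborel_n m). AE t in M. \<forall>y. \<forall>x\<in>space (lborel_n m).
    (\<forall>i<m. x i = h y t i) \<longrightarrow> (t, x) \<in> W"
proof -
  interpret N: sigma_finite_measure "lborel_n m" by (rule sigma_finite_lborel_n)
  let ?N = "lborel_n m"
  have "0 < CARD('p)" by simp
  then have m: "0 < m" using p by linarith
  \<comment> \<open>Only countably many conditions on the measurable \<open>g\<close> occur, so the
    set of \<open>t\<close> selecting a given cell is measurable.\<close>
  define sel where "sel e k q = {t \<in> space M. \<forall>y\<in>C k q. \<forall>i\<in>{..<m}. \<bar>g y t i - g (corner k q) t i\<bar> \<le> e * side k}" for e k q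
  have sel[measurable]: "sel e k q \<in> sets M" for e k q
    unfolding sel_def
    by (intro sets.sets_Collect_countable_All' C(1) countable_finite borel_measurable_le
        borel_measurable_abs borel_measurable_diff g borel_measurable_const) auto
  \<comment> \<open>Discarding \<open>t\<close> when a coarser cell containing this one is already
    selected leaves the maximal selected cells, as the packing bound requires.\<close>
  define first where "first e k q = sel e k q - (\<Union>j<k. sel e j (cell j (corner k q :: real^'p)))" for e k q
  have first[measurable]: "first e k q \<in> sets M" for e k q
    unfolding first_def by measurable
  define U where "U e k q = {z \<in> space (M \<Otimes>\<^sub>M ?N). fst z \<in> first e k q \<and>
      (\<forall>i\<in>{..<m}. \<bar>snd z i - g (corner k q) (fst z) i\<bar> \<le> e * side k)}" for e k q
  have U[measurable]: "U e k q \<in> sets (M \<Otimes>\<^sub>M ?N)" for e k q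
  proof -
    have "{z \<in> space (M \<Otimes>\<^sub>M ?N). \<forall>i\<in>{..<m}. \<bar>snd z i - g (corner k q) (fst z) i\<bar> \<le> e * side k}
        \<in> sets (M \<Otimes>\<^sub>M ?N)"
    proof (intro sets.sets_Collect_countable_All' borel_measurable_le borel_measurable_abs
        borel_measurable_diff borel_measurable_const)
      fix i assume "i \<in> {..<m}"
      then have i: "i < m" by simp
      show "(\<lambda>z. snd z i) \<in> borel_measurable (M \<Otimes>\<^sub>M ?N)"
        by (rule measurable_compose[OF measurable_snd measurable_coordinate[OF i]])
      show "(\<lambda>z. g (corner k q) (fst z) i) \<in> borel_measurable (M \<Otimes>\<^sub>M ?N)"
        by (rule measurable_compose[OF measurable_fst g[OF i]])
    qed simp
    moreover have "U e k q = (first e k q \<times> space ?N) \<inter>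
        {z \<in> space (M \<Otimes>\<^sub>M ?N). \<forall>i\<in>{..<m}. \<bar>snd z i - g (corner k q) (fst z) i\<bar> \<le> e * side k}"
      using sets.sets_into_space[OF first[of e k q]] by (auto simp: U_def space_pair_measure)
    ultimately show ?thesis by auto
  qed
  \<comment> \<open>The 2 cancels the doubling from radius to side length, and
    \<open>2 * eps n\<close> \<le> 1 allows the power \<open>m\<close> to be replaced by the first
    power.\<close>
  define eps :: "nat \<Rightarrow> real" where "eps n = 1 / (2 * real (Suc n))" for n
  have eps: "0 < eps n" for n by (simp add: eps_def)
  define V where "V e q0 = (\<Union>k. \<Union>q\<in>{q. cell 0 (corner k q :: real^'p) = q0}. U e k q)" for e q0
  have V[measurable]: "V e q0 \<in> sets (M \<Otimes>\<^sub>M ?N)" for e q0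
    unfolding V_def by (intro sets.countable_UN' sets.countable_UN) auto
  \<comment> \<open>The packing bound holds over one unit cell at a time, so the limit in
    \<open>n\<close> is taken separately for each \<open>q0\<close>.\<close>
  define W where "W = (\<Union>q0. \<Inter>n. V (eps n) q0)"
  have "emeasure ?N (Pair t -` V (eps n) q0) \<le> ennreal (1 / real (Suc n))" if t: "t \<in> space M" for t n q0
  proof -
    let ?e = "eps n"
    let ?S = "{(k, q). cell 0 (corner k q :: real^'p) = q0 \<and> t \<in> first ?e k q}"
    have "Pair t -` V ?e q0 = (\<Union>(k, q)\<in>?S. {x \<in> space ?N. \<forall>i<m. \<bar>x i - g (corner k q) t i\<bar> \<le> ?e * side k})"
      using t by (auto simp: V_def U_def space_pair_measure) blast
    also have "emeasure ?N \<dots> \<le> ennreal ((2 * ?e) ^ m)"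
    proof (rule emeasure_disjoint_cells_cover[OF p, where ?q0.0 = q0])
      show "(j, cell j (corner k q)) \<notin> ?S" if "(k, q) \<in> ?S" "j < k" for j k q
        using that by (auto simp: first_def)
    qed (use eps[of n] in auto)
    also have "\<dots> \<le> ennreal ((2 * ?e) ^ 1)"
      using m eps[of n] by (intro ennreal_leI power_decreasing) (auto simp: eps_def divide_simps)
    also have "\<dots> = ennreal (1 / real (Suc n))"
      by (simp add: eps_def field_simps)
    finally show ?thesis .
  qed
  note slice = this
  have "(\<Inter>n. V (eps n) q0) \<in> null_sets (M \<Otimes>\<^sub>M ?N)" for q0
  proof -
    have "emeasure ?N (Pair t -` (\<Inter>n. V (eps n) q0)) = 0" if t: "t \<in> space M" for t
    proof -
      have "emeasure ?N (Pair t -` (\<Inter>n. V (eps n) q0)) \<le> ennreal (1 / real (Suc n))" for n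
        using slice[OF t, of n q0]
        by (rule order_trans[rotated]) (intro emeasure_mono sets_Pair1[OF V], auto)
      moreover have "(\<lambda>n. ennreal (1 / real (Suc n))) \<longlonglongrightarrow> ennreal 0"
        by (intro tendsto_ennrealI LIMSEQ_Suc[OF lim_1_over_n])
      ultimately have "emeasure ?N (Pair t -` (\<Inter>n. V (eps n) q0)) \<le> ennreal 0"
        by (intro LIMSEQ_le_const) auto
      then show ?thesis by simp
    qed
    then have "(\<integral>\<^sup>+ t. emeasure ?N (Pair t -` (\<Inter>n. V (eps n) q0)) \<partial>M) = (\<integral>\<^sup>+ t. 0 \<partial>M)"
      by (intro nn_integral_cong) auto
    then show ?thesis
      by (intro null_setsI) (auto simp: N.emeasure_pair_measure_alt)
  qed
  then have "W \<in> null_sets (M \<Otimes>\<^sub>M ?N)"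
    unfolding W_def by (intro null_sets_UN) auto
  moreover have "AE t in M. \<forall>y. \<forall>x\<in>space ?N. (\<forall>i<m. x i = h y t i) \<longrightarrow> (t, x) \<in> W"
    using eq dense flat AE_space
  proof eventually_elim
    case (elim t)
    have "(t, x) \<in> V (eps n) (cell 0 y)" if x: "x \<in> space ?N" "\<forall>i<m. x i = h y t i" for x y n
    proof -
      let ?e = "eps n"
      have sel_iff: "t \<in> sel ?e k q \<longleftrightarrow>
          (\<forall>y\<in>C k q. \<forall>i<m. \<bar>h y t i - h (corner k q) t i\<bar> \<le> ?e * side k)" for k q
        using elim(1) C(2)[of k q] elim(4) by (auto simp: sel_def)
      \<comment> \<open>Flatness is centred at \<open>y\<close> but selection at the corner; half
        the tolerance pays for the change of centre.\<close>
      obtain k where k: "\<And>y' i. cell k y' = cell k y \<Longrightarrow> i < m \<Longrightarrow> \<bar>h y' t i - h y t i\<bar> \<le> ?e / 2 * side k"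
        using elim(3)[THEN spec, of y, THEN spec, of "?e / 2"] eps[of n] by auto
      have "t \<in> sel ?e k (cell k y)"
        unfolding sel_iff
      proof safe
        fix y' i assume "y' \<in> C k (cell k y)" and i: "i < m"
        then have "\<bar>h y' t i - h y t i\<bar> \<le> ?e / 2 * side k"
          using k C(3) by blast
        moreover have "\<bar>h (corner k (cell k y)) t i - h y t i\<bar> \<le> ?e / 2 * side k"
          using k i by simp
        ultimately show "\<bar>h y' t i - h (corner k (cell k y)) t i\<bar> \<le> ?e * side k"
          by linarith
      qed
      \<comment> \<open>The least such scale gives the largest selected cell around
        \<open>y\<close>, hence membership in \<open>first\<close>.\<close>
      then obtain k where sel_k: "t \<in> sel ?e k (cell k y)"
        and least: "\<And>j. j < k \<Longrightarrow> t \<notin> sel ?e j (cell j y)"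
        using exists_least_iff[of "\<lambda>k. t \<in> sel ?e k (cell k y)"] by blast
      have "cell j (corner k (cell k y)) = cell j y" if "j \<le> k" for j
        using cell_coarser[OF that, of "corner k (cell k y)" y] by simp
      then have "t \<in> first ?e k (cell k y)" "cell 0 (corner k (cell k y)) = cell 0 y"
        using sel_k least by (auto simp: first_def)
      moreover have "\<forall>i<m. \<bar>x i - g (corner k (cell k y)) t i\<bar> \<le> ?e * side k"
      proof -
        \<comment> \<open>The point \<open>y\<close> need not be a test point; \<open>dense\<close>
          carries the bound from the test set to the whole cell.\<close>
        have "\<forall>i<m. \<bar>h y t i - h (corner k (cell k y)) t i\<bar> \<le> ?e * side k"
          using elim(2) sel_k unfolding sel_iff by blast
        moreover have "\<forall>i<m. h (corner k (cell k y)) t i = g (corner k (cell k y)) t i"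
          using elim(1) C(2) by blast
        ultimately show ?thesis
          using x(2) by simp
      qed
      ultimately show ?thesis
        using x(1) elim(4) by (auto simp: V_def U_def space_pair_measure)
    qed
    then show ?case
      by (auto simp: W_def)
  qed
  ultimately show ?thesis by blast
qed

subsection \<open>Measurability and the null set\<close>

text \<open>Fubini slices over \<open>t\<close>, whereas \<open>stack\<close> lists \<open>x\<close>
  first. The rearrangement preserves the measure because it does so on boxes, which determine a
  product measure.\<close>

lemma distr_stack:
  "(\<lambda>(t, x). stack m d x t) \<in> lborel_n d \<Otimes>\<^sub>M lborel_n m \<rightarrow>\<^sub>M lborel_n (m + d)" (is "?f \<in> ?P \<rightarrow>\<^sub>M _")
  "distr (lborel_n d \<Otimes>\<^sub>M lborel_n m) (lborel_n (m + d)) (\<lambda>(t, x). stack m d x t) = lborel_n (m + d)"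
proof -
  interpret product_sigma_finite "\<lambda>i::nat. lborel :: real measure" by standard
  interpret N: sigma_finite_measure "lborel_n m" by (rule sigma_finite_lborel_n)
  show f: "?f \<in> ?P \<rightarrow>\<^sub>M lborel_n (m + d)"
    unfolding stack_def lborel_n_def[of "m + d"] case_prod_beta
  proof (rule measurable_restrict)
    fix i assume "i \<in> {..<m + d}"
    then consider "i < m" | "\<not> i < m" "i - m < d" by fastforce
    then show "(\<lambda>p. if i < m then snd p i else fst p (i - m)) \<in> ?P \<rightarrow>\<^sub>M lborel"
    proof cases
      case 1
      then show ?thesis
        using measurable_compose[OF measurable_snd measurable_coordinate[OF 1], of "lborel_n d"] by simp
    next
      case 2
      then show ?thesis
        using measurable_compose[OF measurable_fst measurable_coordinate[OF 2(2)], of "lborel_n m"] by simp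
    qed
  qed
  show "distr ?P (lborel_n (m + d)) ?f = lborel_n (m + d)"
    unfolding lborel_n_def[of "m + d"]
  proof (rule PiM_eqI)
    fix A :: "nat \<Rightarrow> real set"
    assume A: "\<And>i. i \<in> {..<m + d} \<Longrightarrow> A i \<in> sets lborel"
    let ?T = "\<Pi>\<^sub>E i\<in>{..<d}. A (m + i)" and ?X = "\<Pi>\<^sub>E i\<in>{..<m}. A i"
    have sets: "Pi\<^sub>E {..<m + d} A \<in> sets (Pi\<^sub>M {..<m + d} (\<lambda>i. lborel))"
      using A by (intro sets_PiM_I_finite) auto
    have "stack m d x t \<in> Pi\<^sub>E {..<m + d} A \<longleftrightarrow> t \<in> ?T \<and> x \<in> ?X"
      if "t \<in> space (lborel_n d)" "x \<in> space (lborel_n m)" for t x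
    proof -
      have "stack m d x t \<in> Pi\<^sub>E {..<m + d} A \<longleftrightarrow>
          (\<forall>i<m + d. (if i < m then x i else t (i - m)) \<in> A i)"
        by (auto simp: stack_def PiE_iff)
      also have "\<dots> \<longleftrightarrow> (\<forall>i<m. x i \<in> A i) \<and> (\<forall>i<d. t i \<in> A (m + i))"
        by (auto split: if_splits)
           (metis add_diff_cancel_left' add_less_cancel_left not_add_less1,
            metis add_diff_inverse_nat nat_add_left_cancel_less)
      finally show ?thesis
        using that by (auto simp: lborel_n_def space_PiM PiE_iff)
    qed
    then have "?f -` Pi\<^sub>E {..<m + d} A \<inter> space ?P = (?T \<inter> space (lborel_n d)) \<times> (?X \<inter> space (lborel_n m))"
      by (auto simp: space_pair_measure)
    also have "\<dots> = ?T \<times> ?X"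
      by (auto simp: lborel_n_def space_PiM PiE_iff)
    finally have vim: "?f -` Pi\<^sub>E {..<m + d} A \<inter> space ?P = ?T \<times> ?X" .
    have "?T \<in> sets (lborel_n d)" "?X \<in> sets (lborel_n m)"
      unfolding lborel_n_def using A by (auto intro!: sets_PiM_I_finite)
    then have "emeasure ?P (?T \<times> ?X) = emeasure (lborel_n d) ?T * emeasure (lborel_n m) ?X"
      by (rule N.emeasure_pair_measure_Times)
    also have "emeasure (lborel_n d) ?T = (\<Prod>i<d. emeasure lborel (A (m + i)))"
      unfolding lborel_n_def using A by (intro emeasure_PiM) auto
    also have "emeasure (lborel_n m) ?X = (\<Prod>i<m. emeasure lborel (A i))"
      unfolding lborel_n_def using A by (intro emeasure_PiM) auto
    also have "(\<Prod>i<d. emeasure lborel (A (m + i))) * (\<Prod>i<m. emeasure lborel (A i)) =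
        (\<Prod>i<m + d. emeasure lborel (A i))"
      by (induction d) (auto simp: mult_ac)
    finally show "emeasure (distr ?P (Pi\<^sub>M {..<m + d} (\<lambda>i. lborel)) ?f) (Pi\<^sub>E {..<m + d} A) =
        (\<Prod>i<m + d. emeasure lborel (A i))"
      using f sets vim by (simp add: emeasure_distr lborel_n_def[of "m + d"])
  qed auto
qed

text \<open>Instead of measuring a direct image, \<open>E\<close> is enclosed in the preimage
  \<open>A\<close> of \<open>W\<close> under the measurable inverse \<open>u\<close> of stacking.
  Completeness then makes \<open>E\<close> itself null.\<close>

lemma stack_image_null:
  assumes W: "W \<in> null_sets (lborel_n d \<Otimes>\<^sub>M lborel_n m)"
    and E: "E \<subseteq> (\<lambda>(t, x). stack m d x t) ` (W \<inter> space (lborel_n d \<Otimes>\<^sub>M lborel_n m))"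
  shows "E \<in> null_sets (lebesgue_n (m + d))"
proof -
  let ?f = "\<lambda>(t, x). stack m d x t" and ?P = "lborel_n d \<Otimes>\<^sub>M lborel_n m"
  define u where "u z = (\<lambda>i\<in>{..<d}. z (m + i), \<lambda>i\<in>{..<m}. z i)" for z :: "nat \<Rightarrow> real"
  have u_stack: "u (?f p) = p" if "p \<in> space ?P" for p
    using that
    by (auto simp: u_def stack_def space_pair_measure lborel_n_def space_PiM PiE_iff
        extensional_def fun_eq_iff split: prod.splits)
  have comp: "(\<lambda>x. x i) \<in> lborel_n (m + d) \<rightarrow>\<^sub>M lborel" if "i < m + d" for i :: nat
    using measurable_coordinate[OF that] by simp
  have u: "u \<in> lborel_n (m + d) \<rightarrow>\<^sub>M ?P"
    unfolding u_def lborel_n_def[of d] lborel_n_def[of m]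
    by (intro measurable_Pair measurable_restrict comp) auto
  define A where "A = u -` W \<inter> space (lborel_n (m + d))"
  have A: "A \<in> sets (lborel_n (m + d))"
    unfolding A_def using W u by (auto intro: measurable_sets)
  have "emeasure (lborel_n (m + d)) A = emeasure ?P (?f -` A \<inter> space ?P)"
    by (subst distr_stack(2)[symmetric]) (rule emeasure_distr[OF distr_stack(1) A])
  also have "?f -` A \<inter> space ?P = W \<inter> space ?P"
    using measurable_space[OF distr_stack(1)[of m d]] u_stack by (auto simp: A_def)
  also have "emeasure ?P \<dots> = 0"
    using W sets.Int_space_eq2[of W ?P] by (simp add: null_sets_def)
  finally have "A \<in> null_sets (lborel_n (m + d))"
    using A by auto
  moreover have "E \<subseteq> A"
  proof
    fix z assume "z \<in> E"
    then obtain p where p: "p \<in> W" "p \<in> space ?P" "z = ?f p"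
      using E by blast
    then show "z \<in> A"
      using measurable_space[OF distr_stack(1) p(2)] u_stack[OF p(2)] by (simp add: A_def)
  qed
  ultimately show ?thesis
    unfolding lebesgue_n_def by (blast intro: null_sets_completion_subset null_sets_completionI)
qed

section \<open>Measurable sections by approximation from good points\<close>

lemma AE_lborel_ball:
  fixes c :: "'a::euclidean_space"
  assumes "AE x in lborel. P x" "0 < e"
  shows "\<exists>x\<in>ball c e. P x"
proof (rule ccontr)
  assume "\<not> ?thesis"
  with assms(1) have "AE x in lborel. x \<notin> ball c e"
    by (auto elim!: eventually_mono)
  then have "ball c e \<in> null_sets lborel"
    by (simp add: AE_iff_null_sets)
  then have "negligible (ball c e)"
    by (simp add: negligible_iff_null_sets null_sets_completionI)
  moreover have "ball c e \<noteq> {}" using assms(2) by simp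
  ultimately show False
    using open_not_negligible[OF open_ball, of c e] by blast
qed

text \<open>Balls have positive measure, so good points are dense. The exceptional \<open>w\<close>
  depend on \<open>y\<close>, hence \<open>y\<close> is chosen first and \<open>w\<close>
  afterwards.\<close>

lemma AE_lborel_sequence:
  fixes z :: "'a::euclidean_space \<times> 'b::euclidean_space"
  assumes "AE y in lborel. AE w in lborel. P y w"
  obtains Y W where "\<And>n. P (Y n) (W n)" "(\<lambda>n. (Y n, W n)) \<longlonglongrightarrow> z"
proof -
  have "\<exists>y w. P y w \<and> dist y (fst z) < 1 / Suc n \<and> dist w (snd z) < 1 / Suc n" for n
  proof -
    have pos: "(0::real) < 1 / Suc n" by simp
    obtain y where y: "dist y (fst z) < 1 / Suc n" "AE w in lborel. P y w"
      using AE_lborel_ball[OF assms pos, of "fst z"] by (auto simp: dist_commute)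
    obtain w where "dist w (snd z) < 1 / Suc n" "P y w"
      using AE_lborel_ball[OF y(2) pos, of "snd z"] by (auto simp: dist_commute)
    with y show ?thesis by blast
  qed
  then obtain Y W where YW: "\<And>n. P (Y n) (W n)" "\<And>n. dist (Y n) (fst z) < 1 / Suc n" "\<And>n. dist (W n) (snd z) < 1 / Suc n"
    by metis
  have lim: "X \<longlonglongrightarrow> x" if "\<And>n. dist (X n) x < 1 / Suc n" for X and x :: "'c::metric_space"
  proof -
    have "(\<lambda>n. dist (X n) x) \<longlonglongrightarrow> 0"
      by (rule tendsto_sandwich[OF _ _ tendsto_const LIMSEQ_Suc[OF lim_1_over_n]])
         (use that less_imp_le in \<open>auto intro!: always_eventually simp del: of_nat_Suc\<close>)
    then show ?thesis by (rule tendsto_dist_iff[THEN iffD2])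
  qed
  have "(\<lambda>n. (Y n, W n)) \<longlonglongrightarrow> (fst z, snd z)"
    by (intro tendsto_Pair lim YW)
  then show ?thesis using YW(1) by (intro that) auto
qed

text \<open>
  A Lebesgue measurable function of \<open>(y, w, t)\<close> has measurable \<open>t\<close>-sections only for almost every
  \<open>(y, w)\<close>; continuity in \<open>(y, w)\<close> upgrades this to every \<open>(y, w)\<close>.
\<close>

lemma AE_borel_section:
  fixes f :: "real^'p \<Rightarrow> real^'q \<Rightarrow> (nat \<Rightarrow> real) \<Rightarrow> nat \<Rightarrow> real"
  assumes f: "leb_measurable m d f" and i: "i < m"
    and cont: "AE t in lborel_n d. continuous_on UNIV (\<lambda>(y, w). f y w t i)"
  shows "\<exists>g\<in>borel_measurable (lborel_n d). AE t in lborel_n d. f y w t i = g t"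
proof -
  let ?N = "lborel_n d"
  interpret N: sigma_finite_measure ?N by (rule sigma_finite_lborel_n)
  interpret P1: pair_sigma_finite "lborel :: (real^'q) measure" ?N by standard
  interpret P: pair_sigma_finite "lborel :: (real^'p) measure" "(lborel :: (real^'q) measure) \<Otimes>\<^sub>M ?N" by standard
  let ?M = "(lborel :: (real^'p) measure) \<Otimes>\<^sub>M (lborel :: (real^'q) measure) \<Otimes>\<^sub>M ?N"
  have "(\<lambda>x. x i) \<in> borel_measurable (lborel_n m)"
    using i by (rule measurable_coordinate)
  then have "(\<lambda>z. (case z of (y, w, t) \<Rightarrow> f y w t) i) \<in> borel_measurable (completion ?M)"
    using f unfolding leb_measurable_def by (rule measurable_compose[rotated])
  then obtain G where G: "G \<in> borel_measurable ?M"
    "AE z in ?M. (case z of (y, w, t) \<Rightarrow> f y w t) i = G z"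
    using completion_ex_borel_measurable_real by blast
  have ae: "AE y in lborel. AE w in lborel. AE t in ?N. f y w t i = G (y, w, t)"
    using P.AE_pair[OF G(2)] by (rule AE_mp) (auto dest!: P1.AE_pair)
  obtain Y V where YV: "\<And>n. AE t in ?N. f (Y n) (V n) t i = G (Y n, V n, t)"
    "(\<lambda>n. (Y n, V n)) \<longlonglongrightarrow> (y, w)"
    using AE_lborel_sequence[OF ae, of "(y, w)"] by blast
  \<comment> \<open>A limit of Borel sections is Borel. Where the sequence diverges,
    \<open>lim\<close> takes some default value, which affects only exceptional
    \<open>t\<close>.\<close>
  define g where "g t = lim (\<lambda>n. G (Y n, V n, t))" for t
  have "(\<lambda>t. G (Y n, V n, t)) \<in> borel_measurable ?N" for n
    by (rule measurable_compose[OF _ G(1)]) auto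
  then have "g \<in> borel_measurable ?N"
    unfolding g_def by (rule borel_measurable_lim_metric)
  moreover have "AE t in ?N. \<forall>n. f (Y n) (V n) t i = G (Y n, V n, t)"
    using YV(1) by (subst AE_all_countable) auto
  with cont have "AE t in ?N. f y w t i = g t"
  proof eventually_elim
    case (elim t)
    have "(\<lambda>n. (\<lambda>(y, w). f y w t i) (Y n, V n)) \<longlonglongrightarrow> (\<lambda>(y, w). f y w t i) (y, w)"
      by (rule continuous_on_tendsto_compose[OF elim(1) YV(2)]) auto
    then show ?case
      using elim(2) by (simp add: g_def limI)
  qed
  ultimately show ?thesis by blast
qed

section \<open>Jacobian rows and countable test sets\<close>

lemma C1_continuous_on: "C1 g \<Longrightarrow> continuous_on UNIV g"
  unfolding C1_def by (metis has_derivative_continuous continuous_at_imp_continuous_on)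

text \<open>The chain rule along coordinate lines identifies the scalar derivatives in
  \<open>jac_row\<close> with values of the total derivative on \<open>(0, axis j 1)\<close>;
  linearity gives all \<open>v\<close>.\<close>

lemma C1_jac_row:
  fixes f :: "real^'p \<Rightarrow> real^'q \<Rightarrow> (nat \<Rightarrow> real) \<Rightarrow> nat \<Rightarrow> real"
  assumes "C1 (\<lambda>(y, w). f y w t i)"
  shows "\<exists>D. \<forall>z. ((\<lambda>(y, w). f y w t i) has_derivative D z) (at z) \<and>
    (\<forall>v. D z (0, v) = jac_row f t z i \<bullet> v)"
proof -
  let ?g = "\<lambda>(y, w). f y w t i"
  obtain D' where D': "\<forall>z. (?g has_derivative blinfun_apply (D' z)) (at z)"
    using assms unfolding C1_def by blast
  define D where "D z = blinfun_apply (D' z)" for z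
  have D: "(?g has_derivative D z) (at z)" for z
    using D' unfolding D_def by (rule spec)
  have "D z (0, v) = jac_row f t z i \<bullet> v" for z v
  proof -
    have lin: "linear (D z)"
      using D has_derivative_linear by blast
    have axis: "jac_row f t z i $ j = D z (0, axis j 1)" for j
    proof -
      have "((\<lambda>s::real. (fst z, snd z + s *\<^sub>R axis j 1)) has_derivative (\<lambda>s. (0, s *\<^sub>R axis j 1))) (at 0)"
        by (auto intro!: derivative_eq_intros)
      then have "((\<lambda>s::real. ?g (fst z, snd z + s *\<^sub>R axis j 1)) has_derivative (\<lambda>s. D z (0, s *\<^sub>R axis j 1))) (at 0)"
        by (rule has_derivative_compose) (simp add: D)
      moreover have "D z (0, s *\<^sub>R axis j 1) = D z (0, axis j 1) * s" for s
        using linear_scale[OF lin, of s "(0, axis j 1)"] by simp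
      ultimately have "((\<lambda>s::real. f (fst z) (snd z + s *\<^sub>R axis j 1) t i) has_field_derivative D z (0, axis j 1)) (at 0)"
        by (simp add: has_field_derivative_def)
      then show ?thesis
        by (simp add: jac_row_def DERIV_imp_deriv)
    qed
    have v: "v = (\<Sum>j\<in>UNIV. v $ j *\<^sub>R axis j 1)"
      using basis_expansion[of v] by (simp add: scalar_mult_eq_scaleR)
    have lin0: "linear (\<lambda>u. D z (0, u))"
      by (rule linear_compose[OF _ lin, unfolded o_def]) (auto intro!: linearI)
    have "D z (0, v) = (\<Sum>j\<in>UNIV. v $ j * D z (0, axis j 1))"
      by (subst v) (simp add: linear_sum[OF lin0] linear_scale[OF lin0])
    also have "\<dots> = jac_row f t z i \<bullet> v"
      by (simp add: inner_vec_def axis mult.commute)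
    finally show ?thesis .
  qed
  then show ?thesis using D by blast
qed

text \<open>No continuity of \<open>\<psi>\<close> is assumed, so points dense in \<open>S\<close>
  alone would not control the values of \<open>\<psi>\<close>. Separability is therefore applied to
  the graph, and the dense part is projected back.\<close>

lemma countable_dense_graph:
  fixes \<psi> :: "real^'p \<Rightarrow> real^'q"
  shows "\<exists>C. countable C \<and> C \<subseteq> S \<and> (\<lambda>y. (y, \<psi> y)) ` S \<subseteq> closure ((\<lambda>y. (y, \<psi> y)) ` C)"
proof -
  obtain T where T: "countable T" "T \<subseteq> (\<lambda>y. (y, \<psi> y)) ` S" "(\<lambda>y. (y, \<psi> y)) ` S \<subseteq> closure T"
    by (rule separable)
  then have "T = (\<lambda>y. (y, \<psi> y)) ` fst ` T"
    by force
  then show ?thesis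
    using T by (intro exI[of _ "fst ` T"]) auto
qed

lemma abs_diff_le_on_closure:
  fixes \<phi> :: "'a::topological_space \<Rightarrow> real"
  assumes "continuous_on UNIV \<phi>" "\<And>x. x \<in> T \<Longrightarrow> \<bar>\<phi> x - c\<bar> \<le> e" "z \<in> closure T"
  shows "\<bar>\<phi> z - c\<bar> \<le> e"
proof -
  have "closed {x. \<bar>\<phi> x - c\<bar> \<le> e}"
    using assms(1) by (intro closed_Collect_le continuous_intros)
  then have "closure T \<subseteq> {x. \<bar>\<phi> x - c\<bar> \<le> e}"
    using assms(2) by (intro closure_minimal) auto
  then show ?thesis using assms(3) by auto
qed

theorem theorem2:
  "\<exists>\<psi> :: real^'p::finite \<Rightarrow> real^'q::finite.
     \<forall>(n::nat) (d::nat) (f :: real^'p \<Rightarrow> real^'q \<Rightarrow> (nat \<Rightarrow> real) \<Rightarrow> (nat \<Rightarrow> real)).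
       0 < d \<longrightarrow> d < n \<longrightarrow> CARD('p) \<le> n - d \<longrightarrow> n - d \<le> CARD('q) \<longrightarrow>
       leb_measurable (n - d) d f \<longrightarrow>
       (AE t in lebesgue_n d.
          (\<forall>i<n - d. C1 (\<lambda>(y, w). f y w t i)) \<and>
          (\<forall>z. rows_rank (n - d) (jac_row f t z) = n - d) \<and>
          rows_lipschitz (n - d) (jac_row f t)) \<longrightarrow>
       E_set n d f \<psi> \<in> null_sets (lebesgue_n n)"
proof -
  obtain L :: "nat \<Rightarrow> real^'p^'q" where L: "\<And>k. onorm ((*v) (L k)) \<le> real k"
    and dense_L: "\<And>M e. 0 < e \<Longrightarrow> \<exists>M'. dist M' M < e \<and> (\<forall>n. \<exists>k\<ge>n. L k = M')"
    using exists_dense_sequence by metis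
  \<comment> \<open>\<open>L\<close> depends only on the two index types and is fixed before
    \<open>n\<close>, \<open>d\<close> and \<open>f\<close>, so one function serves them
    all.\<close>
  let ?\<psi> = "staircase L"
  have "E_set n d f ?\<psi> \<in> null_sets (lebesgue_n n)"
    if d: "d < n" and p: "CARD('p) \<le> n - d" and meas: "leb_measurable (n - d) d f"
      and good: "AE t in lebesgue_n d. (\<forall>i<n - d. C1 (\<lambda>(y, w). f y w t i)) \<and>
        (\<forall>z. rows_rank (n - d) (jac_row f t z) = n - d) \<and> rows_lipschitz (n - d) (jac_row f t)"
    for n d and f :: "real^'p \<Rightarrow> real^'q \<Rightarrow> (nat \<Rightarrow> real) \<Rightarrow> (nat \<Rightarrow> real)"
  proof -
    define m where "m = n - d"
    have n: "n = m + d" using d by (simp add: m_def)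
    let ?N = "lborel_n d"
    have good: "AE t in ?N. (\<forall>i<m. C1 (\<lambda>(y, w). f y w t i)) \<and> (\<forall>z. rows_rank m (jac_row f t z) = m)"
      using good unfolding lebesgue_n_def AE_completion_iff m_def by (rule AE_mp) simp
    define h where "h y t i = f y (?\<psi> y) t i" for y t i
    have "\<exists>G\<in>borel_measurable ?N. AE t in ?N. h y t i = G t" if "i < m" for y i
      unfolding h_def
    proof (rule AE_borel_section[OF meas[folded m_def] that])
      show "AE t in ?N. continuous_on UNIV (\<lambda>(y, w). f y w t i)"
        using good by (rule AE_mp) (use that in \<open>simp add: C1_continuous_on\<close>)
    qed
    then have "\<forall>y i. \<exists>G. i < m \<longrightarrow> G \<in> borel_measurable ?N \<and> (AE t in ?N. h y t i = G t)"
      by blast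
    then have "\<exists>G. \<forall>y i. i < m \<longrightarrow> G y i \<in> borel_measurable ?N \<and> (AE t in ?N. h y t i = G y i t)"
      by (intro choice allI) blast
    then obtain G where G: "\<And>y i. i < m \<Longrightarrow> G y i \<in> borel_measurable ?N"
      "\<And>y i. i < m \<Longrightarrow> AE t in ?N. h y t i = G y i t"
      by blast
    have "\<exists>C. countable C \<and> C \<subseteq> {y. cell k y = q} \<and>
        (\<lambda>y. (y, ?\<psi> y)) ` {y. cell k y = q} \<subseteq> closure ((\<lambda>y. (y, ?\<psi> y)) ` C)" for k q
      by (rule countable_dense_graph)
    then have "\<exists>C. \<forall>k q. countable (C k q) \<and> C k q \<subseteq> {y. cell k y = q} \<and>
        (\<lambda>y. (y, ?\<psi> y)) ` {y. cell k y = q} \<subseteq> closure ((\<lambda>y. (y, ?\<psi> y)) ` C k q)"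
      by (intro choice allI)
    then obtain C where C': "\<forall>k q. countable (C k q) \<and> C k q \<subseteq> {y. cell k y = q} \<and>
        (\<lambda>y. (y, ?\<psi> y)) ` {y. cell k y = q} \<subseteq> closure ((\<lambda>y. (y, ?\<psi> y)) ` C k q)"
      by (rule exE)
    note C = C'[THEN spec, THEN spec, THEN conjunct1]
      C'[THEN spec, THEN spec, THEN conjunct2, THEN conjunct1]
      C'[THEN spec, THEN spec, THEN conjunct2, THEN conjunct2]
    have "\<exists>W\<in>null_sets (?N \<Otimes>\<^sub>M lborel_n m). AE t in ?N. \<forall>y. \<forall>x\<in>space (lborel_n m).
        (\<forall>i<m. x i = h y t i) \<longrightarrow> (t, x) \<in> W"
    \<comment> \<open>The corner is the reference point of the oscillation test, so it is added to
      the test set.\<close>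
    proof (rule null_cover_of_flat_cells[where g = "\<lambda>y t i. G y i t" and C = "\<lambda>k q. insert (corner k q) (C k q)"])
      show "sigma_finite_measure ?N" by (rule sigma_finite_lborel_n)
      show "CARD('p) \<le> m" using p by (simp add: m_def)
      show "(\<lambda>t. G y i t) \<in> borel_measurable ?N" if "i < m" for y i
        using G(1)[OF that] by simp
      show "countable (insert (corner k q) (C k q))" for k q using C(1) by simp
      show "corner k q \<in> insert (corner k q) (C k q)" for k q by simp
      show "cell k y = q" if "y \<in> insert (corner k q) (C k q)" for k q y
        using that C(2)[of k q] by auto
      \<comment> \<open>The null set off which \<open>h\<close> agrees with \<open>G\<close> depends
        on \<open>y\<close>; countability of the test set keeps the union of these sets
        null.\<close>
      have "AE t in ?N. \<forall>y\<in>insert (corner k q) (C k q). \<forall>i\<in>{..<m}. h y t i = G y i t" for k q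
        using C(1) G(2) by (intro AE_ball_countable[THEN iffD2] ballI) auto
      then have "AE t in ?N. \<forall>k q. \<forall>y\<in>insert (corner k q) (C k q). \<forall>i\<in>{..<m}. h y t i = G y i t"
        by (intro AE_all_countable[THEN iffD2] allI)
      then show "AE t in ?N. \<forall>k q. \<forall>y\<in>insert (corner k q) (C k q). \<forall>i<m. h y t i = G y i t"
        by (simp add: Ball_def)
      show "AE t in ?N. \<forall>k q e. (\<forall>y\<in>insert (corner k q) (C k q). \<forall>i<m. \<bar>h y t i - h (corner k q) t i\<bar> \<le> e) \<longrightarrow>
          (\<forall>y. cell k y = q \<longrightarrow> (\<forall>i<m. \<bar>h y t i - h (corner k q) t i\<bar> \<le> e))"
        using good
      proof eventually_elim
        case (elim t)
        show ?case
        proof (intro allI impI)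
          fix k e i q and y :: "real^'p"
          assume C_e: "\<forall>y\<in>insert (corner k q) (C k q). \<forall>i<m. \<bar>h y t i - h (corner k q) t i\<bar> \<le> e"
            and y: "cell k y = q" and i: "i < m"
          let ?\<phi> = "\<lambda>(y, w). f y w t i"
          \<comment> \<open>The bound is a closed condition on the graph point because
            \<open>f\<close> is continuous in \<open>(y, w)\<close>, even though \<open>h\<close>
            itself need not be continuous in \<open>y\<close>.\<close>
          have "\<bar>?\<phi> (y, ?\<psi> y) - h (corner k q) t i\<bar> \<le> e"
          proof (rule abs_diff_le_on_closure[where \<phi> = ?\<phi> and T = "(\<lambda>y. (y, ?\<psi> y)) ` C k q"])
            show "continuous_on UNIV ?\<phi>"
              using elim i C1_continuous_on by blast
            show "(y, ?\<psi> y) \<in> closure ((\<lambda>y. (y, ?\<psi> y)) ` C k q)"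
              using C(3)[of k q] y by blast
            show "\<bar>?\<phi> z - h (corner k q) t i\<bar> \<le> e" if "z \<in> (\<lambda>y. (y, ?\<psi> y)) ` C k q" for z
              using that C_e i by (auto simp: h_def)
          qed
          then show "\<bar>h y t i - h (corner k q) t i\<bar> \<le> e"
            by (simp add: h_def)
        qed
      qed
      show "AE t in ?N. \<forall>y e. 0 < e \<longrightarrow> (\<exists>k. \<forall>y'. cell k y' = cell k y \<longrightarrow>
          (\<forall>i<m. \<bar>h y' t i - h y t i\<bar> \<le> e * side k))"
        using good
      proof eventually_elim
        case (elim t)
        have "\<forall>i\<in>{..<m}. \<exists>D. \<forall>z. ((\<lambda>(y, w). f y w t i) has_derivative D z) (at z) \<and>
            (\<forall>v. D z (0, v) = jac_row f t z i \<bullet> v)"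
          by (intro ballI C1_jac_row) (use elim in simp)
        from bchoice[OF this] obtain D where "\<forall>i\<in>{..<m}. \<forall>z. ((\<lambda>(y, w). f y w t i) has_derivative D i z) (at z) \<and>
            (\<forall>v. D i z (0, v) = jac_row f t z i \<bullet> v)"
          by (rule exE)
        then have D: "i < m \<Longrightarrow> ((\<lambda>(y, w). f y w t i) has_derivative D i z) (at z)"
          "i < m \<Longrightarrow> D i z (0, v) = jac_row f t z i \<bullet> v" for i z v
          by (simp_all del: split_paired_All)
        show ?case
        proof (intro allI impI)
          fix y :: "real^'p" and e :: real
          assume e: "0 < e"
          let ?z = "(y, ?\<psi> y)"
          have "\<exists>k. \<forall>y'. cell k y' = cell k y \<longrightarrow> (\<forall>i<m. \<bar>(\<lambda>(y, w). f y w t i) (y', ?\<psi> y') -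
              (\<lambda>(y, w). f y w t i) ?z\<bar> \<le> e * side k)"
            using elim D e
            by (intro staircase_flat[OF L dense_L, where D = "\<lambda>i. D i ?z" and b = "jac_row f t ?z"]) auto
          then show "\<exists>k. \<forall>y'. cell k y' = cell k y \<longrightarrow> (\<forall>i<m. \<bar>h y' t i - h y t i\<bar> \<le> e * side k)"
            by (simp add: h_def)
        qed
      qed
    qed
    then obtain W where W: "W \<in> null_sets (?N \<Otimes>\<^sub>M lborel_n m)"
      and cover: "AE t in ?N. \<forall>y. \<forall>x\<in>space (lborel_n m). (\<forall>i<m. x i = h y t i) \<longrightarrow> (t, x) \<in> W"
      by blast
    obtain Z where Z: "Z \<in> null_sets ?N"
      "\<And>t y x. t \<in> space ?N - Z \<Longrightarrow> x \<in> space (lborel_n m) \<Longrightarrow> (\<forall>i<m. x i = h y t i) \<Longrightarrow> (t, x) \<in> W"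
      using cover unfolding eventually_ae_filter by blast
    interpret N: sigma_finite_measure "lborel_n m" by (rule sigma_finite_lborel_n)
    \<comment> \<open>Over exceptional \<open>t\<close> the whole slice is added; this is still
      null, and now every \<open>t\<close> is covered.\<close>
    have "Z \<times> space (lborel_n m) \<in> null_sets (?N \<Otimes>\<^sub>M lborel_n m)"
      using Z(1) by (intro N.times_in_null_sets1) auto
    then have null: "W \<union> Z \<times> space (lborel_n m) \<in> null_sets (?N \<Otimes>\<^sub>M lborel_n m)"
      using W by (rule null_sets.Un[rotated])
    \<comment> \<open>Measurability into \<open>lborel_n m\<close> makes every value of
      \<open>f\<close> extensional, so \<open>(t, f y w t)\<close> is a point of the product
      space.\<close>
    have f_space: "f y w t \<in> space (lborel_n m)" if "t \<in> space ?N" for y w t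
      using measurable_space[OF meas[unfolded leb_measurable_def], of "(y, w, t)"] that
      by (simp add: space_pair_measure m_def)
    show ?thesis
      unfolding n
    proof (rule stack_image_null[OF null])
      show "E_set (m + d) d f ?\<psi> \<subseteq> (\<lambda>(t, x). stack m d x t) `
          ((W \<union> Z \<times> space (lborel_n m)) \<inter> space (?N \<Otimes>\<^sub>M lborel_n m))"
      proof
        fix u assume "u \<in> E_set (m + d) d f ?\<psi>"
        then obtain y t where t: "t \<in> space ?N" and u: "u = stack m d (f y (?\<psi> y) t) t"
          by (auto simp: E_set_def Gam_def)
        let ?x = "f y (?\<psi> y) t"
        have "(t, ?x) \<in> (W \<union> Z \<times> space (lborel_n m)) \<inter> space (?N \<Otimes>\<^sub>M lborel_n m)"
          using t f_space[OF t] Z(2)[of t ?x y] by (auto simp: h_def space_pair_measure)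
        then show "u \<in> (\<lambda>(t, x). stack m d x t) `
            ((W \<union> Z \<times> space (lborel_n m)) \<inter> space (?N \<Otimes>\<^sub>M lborel_n m))"
          using u by (intro image_eqI[where x = "(t, ?x)"]) auto
      qed
    qed
  qed
  then show ?thesis by blast
qed

end
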